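(* Let $n\geq 1$ and suppose a deck of $n$ cards is shuffled once in a shelf-shuffler with one shelf. Let $p_{i,j}$ be the probability that card $i$ lands in position $j$. Then $$p_{i,j}=\frac{\binom{i-1}{j-1}+\binom{i-1}{n-j}}{2^i},\qquad 1\leq i\leq n,\quad 1\leq j\leq n.$$ In particular, $p_{i,j}=0$ if and only if $i+1\leq j\leq n-i$, and $p_{i,n-j+1}=p_{i,j}$ for all $i,j$.
   Context: Single-shelf shuffle: a deck of cards is initially labeled $1,2,\dots,n$ from top to bottom. Cards are drawn one at a time from the bottom of the deck (so card $n$ is drawn first and card $1$ last) and placed in a pile. Each drawn card is placed, independently of the others, on the top of the existing pile with probability $1/2$ or at the bottom of the existing pile with probability $1/2$. The final pile is the shuffled deck; position $1$ is its top and position $n$ its bottom. Binomial conventions: $\binom{0}{0}=1$, and $\binom{a}{b}=0$ for integers $b>a\geq 0$ (in particular $\binom{0}{k}=0$ for every positive integer $k$). *)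

theory Defs
  imports "HOL-Probability.Probability"
begin

text \<open>
  Decks and piles are lists, listed from top to bottom: the head is the top card, at position 1.
\<close>

definition place_card :: "'a \<Rightarrow> 'a list \<Rightarrow> 'a list pmf" where
  "place_card c pile =
     map_pmf (\<lambda>top. if top then c # pile else pile @ [c]) (bernoulli_pmf (1/2))"

fun place_cards :: "'a list \<Rightarrow> 'a list \<Rightarrow> 'a list pmf" where
  "place_cards [] pile = return_pmf pile"
| "place_cards (c # cs) pile = bind_pmf (place_card c pile) (place_cards cs)"

text \<open>
  Cards are drawn from the bottom of the deck, hence in the order of \<open>rev deck\<close>. Each
  \<open>bind_pmf\<close> above takes a fresh fair coin, so the placements are independent.
\<close>
definition shelf_shuffle :: "'a list \<Rightarrow> 'a list pmf" where
  "shelf_shuffle deck = place_cards (rev deck) []"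

text \<open>
  Positions are counted from 1, whereas list indices start at 0. The bounds on \<open>j\<close> exclude
  out-of-range list access, whose value is unspecified.
\<close>
definition card_position_prob :: "nat \<Rightarrow> nat \<Rightarrow> nat \<Rightarrow> real" where
  "card_position_prob n i j =
     measure_pmf.prob (shelf_shuffle [1..<Suc n])
       {pile. 1 \<le> j \<and> j \<le> length pile \<and> pile ! (j - 1) = i}"

end

theory Submission
  imports Defs
begin

text \<open>
  Until card \<open>i\<close> is drawn, only the size \<open>n - i\<close> of the pile matters. Card \<open>i\<close> then goes to
  index \<open>0\<close> or to index \<open>n - i\<close> (counted from \<open>0\<close>), and each of the \<open>i - 1\<close> later cards pushes
  it down by one exactly when it is placed on top. So its final index is \<open>0\<close> or \<open>n - i\<close>,
  each with probability \<open>1/2\<close>, plus a symmetric binomial variable with parameter \<open>i - 1\<close>.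
\<close>

text \<open>Conditioning on the fair coin of the first drawn card gives an average of two
  probabilities. Later proofs use this recursion in place of
  \<open>place_cards.simps\<close>.\<close>

lemma prob_place_cards_Cons:
  "measure_pmf.prob (place_cards (c # cs) pile) A =
     (measure_pmf.prob (place_cards cs (c # pile)) A
      + measure_pmf.prob (place_cards cs (pile @ [c])) A) / 2"
proof -
  have "measure_pmf.prob (place_cards (c # cs) pile) A =
      measure_pmf.expectation (bernoulli_pmf (1/2))
        (\<lambda>top. measure_pmf.prob (place_cards cs (if top then c # pile else pile @ [c])) A)"
    unfolding place_cards.simps place_card_def bind_map_pmf
    by (subst measure_pmf_bind)
       (subst measure_pmf.measure_bind[where N = "count_space UNIV"],
        auto simp: space_subprob_algebra intro: measure_pmf.subprob_space_axioms)
  then show ?thesis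
    by (simp add: field_simps)
qed

text \<open>Exactly \<open>k - length us\<close> of the remaining cards must go on top. Since
  \<open>x\<close> occurs only once, the event pins down its index. The \<open>if\<close> matters
  because truncated subtraction would otherwise give \<open>choose 0 = 1\<close> for
  \<open>k < length us\<close>.\<close>

lemma prob_position_card_in_pile:
  assumes "x \<notin> set us" "x \<notin> set vs" "x \<notin> set cs"
  shows "measure_pmf.prob (place_cards cs (us @ x # vs))
           {pile. k < length pile \<and> pile ! k = x}
         = (if length us \<le> k then real (length cs choose (k - length us)) else 0) / 2 ^ length cs"
  using assms
proof (induction cs arbitrary: us vs)
  case Nil
  then have "k < length (us @ x # vs) \<and> (us @ x # vs) ! k = x \<longleftrightarrow> k = length us"
    by (auto simp: nth_append nth_Cons' split: if_splits)
  then show ?case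
    by (auto simp: measure_return_pmf indicator_def binomial_eq_0)
next
  case (Cons c cs)
  have top: "measure_pmf.prob (place_cards cs (c # us @ x # vs))
        {pile. k < length pile \<and> pile ! k = x}
      = (if Suc (length us) \<le> k then real (length cs choose (k - Suc (length us))) else 0)
        / 2 ^ length cs"
    using Cons.IH[of "c # us" vs] Cons.prems by auto
  have bottom: "measure_pmf.prob (place_cards cs ((us @ x # vs) @ [c]))
        {pile. k < length pile \<and> pile ! k = x}
      = (if length us \<le> k then real (length cs choose (k - length us)) else 0) / 2 ^ length cs"
    using Cons.IH[of us "vs @ [c]"] Cons.prems by auto
  \<comment> \<open>Both terms vanish in the first case and only \<open>bottom\<close> survives in
    the second; the third is Pascal's rule.\<close>
  consider "k < length us" | "k = length us" | d where "k = Suc (length us + d)"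
    by (metis less_iff_Suc_add linorder_neqE_nat)
  then show ?case
    unfolding prob_place_cards_Cons top bottom by cases (simp_all add: field_simps)
qed

text \<open>The two summands come from \<open>x\<close> landing on top or at the bottom of a pile of
  size \<open>length as + length pile\<close>.\<close>

lemma prob_position_card_in_deck:
  assumes "x \<notin> set pile" "x \<notin> set as" "x \<notin> set bs"
  shows "measure_pmf.prob (place_cards (as @ x # bs) pile)
           {pile. k < length pile \<and> pile ! k = x}
         = (real (length bs choose k)
            + (if length as + length pile \<le> k
               then real (length bs choose (k - (length as + length pile))) else 0))
           / 2 ^ Suc (length bs)"
  using assms
proof (induction as arbitrary: pile)
  case Nil
  then show ?case
    using prob_position_card_in_pile[of x "[]" pile bs k]
      prob_position_card_in_pile[of x pile "[]" bs k]
    by (auto simp: prob_place_cards_Cons field_simps simp del: place_cards.simps)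
next
  case (Cons a as)
  then show ?case
    \<comment> \<open>Both piles have the same length, so the average leaves the value
      unchanged.\<close>
    using Cons.IH[of "a # pile"] Cons.IH[of "pile @ [a]"]
    by (simp add: prob_place_cards_Cons field_simps del: place_cards.simps)
qed

lemma card_position_prob_eq:
  assumes "1 \<le> i" "i \<le> n" "1 \<le> j" "j \<le> n"
  shows "card_position_prob n i j
     = (real ((i - 1) choose (j - 1)) + real ((i - 1) choose (n - j))) / 2 ^ i"
proof -
  have "[1..<Suc n] = [1..<i] @ i # [Suc i..<Suc n]"
    using assms upt_add_eq_append[of 1 i "Suc n - i"] upt_conv_Cons[of i "Suc n"] by simp
  then have deck: "shelf_shuffle [1..<Suc n] = place_cards (rev [Suc i..<Suc n] @ i # rev [1..<i]) []"
    by (simp add: shelf_shuffle_def)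
  have event: "{pile. 1 \<le> j \<and> j \<le> length pile \<and> pile ! (j - 1) = i}
      = {pile. j - 1 < length pile \<and> pile ! (j - 1) = i}"
    using assms by auto
  \<comment> \<open>The lower indices on the two sides add up to \<open>i - 1\<close>, so binomial
    symmetry applies; when the guard fails, \<open>n - j\<close> exceeds \<open>i - 1\<close> and
    both sides are 0.\<close>
  have reflection: "(if n - i \<le> j - 1 then real ((i - 1) choose (j - 1 - (n - i))) else 0)
      = real ((i - 1) choose (n - j))"
  proof (cases "n - i \<le> j - 1")
    case True
    then have "n - j \<le> i - 1" "i - 1 - (n - j) = j - 1 - (n - i)"
      using assms by linarith+
    then show ?thesis
      using True binomial_symmetric[of "n - j" "i - 1"] by simp
  next
    case False
    then have "i - 1 < n - j"
      using assms by linarith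
    then show ?thesis
      using False by (simp add: binomial_eq_0)
  qed
  have lengths: "length (rev [Suc i..<Suc n]) + length [] = n - i" "length (rev [1..<i]) = i - 1"
    "Suc (i - 1) = i"
    using assms by auto
  have "i \<notin> set []" "i \<notin> set (rev [Suc i..<Suc n])" "i \<notin> set (rev [1..<i])"
    by auto
  from prob_position_card_in_deck[OF this, where k = "j - 1"] show ?thesis
    unfolding card_position_prob_def deck event lengths reflection .
qed

theorem theorem1p1:
  fixes n :: nat
  assumes "n \<ge> 1"
  shows "\<forall>i\<in>{1..n}. \<forall>j\<in>{1..n}.
           card_position_prob n i j
             = (real ((i - 1) choose (j - 1)) + real ((i - 1) choose (n - j))) / 2 ^ i
         \<and> (card_position_prob n i j = 0 \<longleftrightarrow> i + 1 \<le> j \<and> j \<le> n - i)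
         \<and> card_position_prob n i (n - j + 1) = card_position_prob n i j"
proof (intro ballI conjI)
  fix i j
  assume ij: "i \<in> {1..n}" "j \<in> {1..n}"
  show formula: "card_position_prob n i j
      = (real ((i - 1) choose (j - 1)) + real ((i - 1) choose (n - j))) / 2 ^ i"
    using ij by (intro card_position_prob_eq) auto
  \<comment> \<open>A sum of two nonnegative terms is 0 only if both binomials vanish.\<close>
  have "card_position_prob n i j = 0 \<longleftrightarrow> i - 1 < j - 1 \<and> i - 1 < n - j"
    unfolding formula by (simp add: add_nonneg_eq_0_iff binomial_eq_0_iff)
  also have "\<dots> \<longleftrightarrow> i + 1 \<le> j \<and> j \<le> n - i"
    using ij by auto
  finally show "card_position_prob n i j = 0 \<longleftrightarrow> i + 1 \<le> j \<and> j \<le> n - i" .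
  show "card_position_prob n i (n - j + 1) = card_position_prob n i j"
    \<comment> \<open>Replacing \<open>j\<close> by \<open>n - j + 1\<close> swaps
      \<open>j - 1\<close> and \<open>n - j\<close>, hence the two binomials.\<close>
    using ij card_position_prob_eq[of i n "n - j + 1"] formula by (auto simp: add.commute)
qed

end
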